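(* Let $G_1=(V_1,E_1)$ and $G_2=(V_2,E_2)$ be simple graphs such that the induced subgraphs of $G_1$ and of $G_2$ on $V_1\cap V_2$ are cliques, and let $G=G_1\boxtimes G_2=(V_1\cup V_2,E_1\cup E_2)$ be their clique sum. Then \[ \mathrm{gcr}(G)=\max\{\mathrm{gcr}(G_1),\mathrm{gcr}(G_2)\}. \]
   Context: For a simple graph $H=(V,E)$ with vertex set $V=[N]$, let $\mathrm{Sym}_N$ be the space of symmetric $N\times N$ matrices, and let $\pi_H:\mathrm{Sym}_N\to \mathbb{R}^{N}\oplus\mathbb{R}^{E}$ be the coordinate projection $(a_{ij})\mapsto \big((a_{ii})_{i\in[N]},(a_{ij})_{\{i,j\}\in E}\big)$. Extend it over $\mathbb{C}$ in the same way. Let $V_r\subset \mathrm{Sym}_N$ be the variety of symmetric matrices of rank at most $r$. The generic completion rank $\mathrm{gcr}(H)$ is the smallest integer $r$ such that the restriction of $\pi_H$ to $V_r$ is dominant, i.e. $\dim \pi_H(V_r)=N+|E|$. *)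

theory Defs
  imports "HOL-Analysis.Analysis"
begin

text \<open>A graph is a pair of a vertex set and an edge set, with edges two-element sets of
  vertices. The vertices live in an arbitrary finite ambient type.\<close>

type_synonym 'v graph = "'v set \<times> 'v set set"

definition simple_graph :: "'v graph \<Rightarrow> bool" where
  "simple_graph G \<longleftrightarrow> finite (fst G) \<and> snd G \<subseteq> {e. e \<subseteq> fst G \<and> card e = 2}"

definition induced_subgraph :: "'v graph \<Rightarrow> 'v set \<Rightarrow> 'v graph" where
  "induced_subgraph G S = (S, {e \<in> snd G. e \<subseteq> S})"

definition clique :: "'v graph \<Rightarrow> bool" where
  "clique G \<longleftrightarrow> snd G = {e. e \<subseteq> fst G \<and> card e = 2}"

definition clique_sum :: "'v graph \<Rightarrow> 'v graph \<Rightarrow> 'v graph" where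
  "clique_sum G\<^sub>1 G\<^sub>2 = (fst G\<^sub>1 \<union> fst G\<^sub>2, snd G\<^sub>1 \<union> snd G\<^sub>2)"

text \<open>Matrices with rows and columns indexed by \<open>V\<close> are represented as matrices over the ambient
  type whose entries outside \<open>V \<times> V\<close> are zero; the padding does not change the rank.\<close>

definition Sym :: "'v::finite set \<Rightarrow> (complex ^ 'v ^ 'v) set" where
  "Sym V = {A. transpose A = A \<and> (\<forall>i j. i \<notin> V \<or> j \<notin> V \<longrightarrow> A $ i $ j = 0)}"

definition Sym_rank_le :: "'v::finite set \<Rightarrow> nat \<Rightarrow> (complex ^ 'v ^ 'v) set" where
  "Sym_rank_le V r = {A \<in> Sym V. rank A \<le> r}"

text \<open>The common value of \<open>A $ i $ j\<close> and \<open>A $ j $ i\<close>, for \<open>e = {i, j}\<close> and symmetric \<open>A\<close>.\<close>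

definition edge_entry :: "complex ^ 'v ^ 'v \<Rightarrow> 'v::finite set \<Rightarrow> complex" where
  "edge_entry A e = (THE z. \<exists>i j. e = {i, j} \<and> z = A $ i $ j)"

lemma edge_entry_doubleton:
  assumes "transpose A = A"
  shows "edge_entry A {i, j} = A $ i $ j"
proof -
  have "A $ b $ a = A $ a $ b" for a b
    using assms by (metis transpose_def vec_lambda_beta)
  then show ?thesis
    unfolding edge_entry_def by (intro the_equality) (auto simp: doubleton_eq_iff)
qed

text \<open>The space \<open>\<complex>\<^sup>I\<close> is the set of extensional functions on \<open>I\<close>. For a graph \<open>(V, E)\<close> the
  coordinate set \<open>V <+> E\<close> gives the direct sum of \<open>\<complex>\<^sup>V\<close> and \<open>\<complex>\<^sup>E\<close>.\<close>

abbreviation affine_space :: "'i set \<Rightarrow> ('i \<Rightarrow> complex) set" where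
  "affine_space I \<equiv> I \<rightarrow>\<^sub>E UNIV"

definition proj :: "'v::finite graph \<Rightarrow> complex ^ 'v ^ 'v \<Rightarrow> ('v + 'v set \<Rightarrow> complex)" where
  "proj H A = (\<lambda>c \<in> fst H <+> snd H. case c of Inl i \<Rightarrow> A $ i $ i | Inr e \<Rightarrow> edge_entry A e)"

inductive poly_fun :: "'i set \<Rightarrow> (('i \<Rightarrow> complex) \<Rightarrow> complex) \<Rightarrow> bool" for I where
  const: "poly_fun I (\<lambda>x. c)"
| coord: "i \<in> I \<Longrightarrow> poly_fun I (\<lambda>x. x i)"
| add: "poly_fun I f \<Longrightarrow> poly_fun I g \<Longrightarrow> poly_fun I (\<lambda>x. f x + g x)"
| mult: "poly_fun I f \<Longrightarrow> poly_fun I g \<Longrightarrow> poly_fun I (\<lambda>x. f x * g x)"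

definition zariski_closure :: "'i set \<Rightarrow> ('i \<Rightarrow> complex) set \<Rightarrow> ('i \<Rightarrow> complex) set" where
  "zariski_closure I S =
    {x \<in> affine_space I. \<forall>f. poly_fun I f \<longrightarrow> (\<forall>y\<in>S. f y = 0) \<longrightarrow> f x = 0}"

definition proj_dominant :: "'v::finite graph \<Rightarrow> nat \<Rightarrow> bool" where
  "proj_dominant H r \<longleftrightarrow>
    zariski_closure (fst H <+> snd H) (proj H ` Sym_rank_le (fst H) r)
      = affine_space (fst H <+> snd H)"

definition gcr :: "'v::finite graph \<Rightarrow> nat" where
  "gcr H = (LEAST r. proj_dominant H r)"

text \<open>The minimum in the definition of \<^const>\<open>gcr\<close> is attained: without a rank restriction,
  the projection is surjective.\<close>

lemma proj_dominant_gcr: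
  fixes H :: "'v::finite graph"
  assumes "simple_graph H"
  shows "proj_dominant H (gcr H)"
proof -
  obtain V E where H: "H = (V, E)" by (cases H)
  let ?I = "V <+> E"
  have "proj H ` Sym_rank_le V (CARD('v)) = affine_space ?I"
  proof (intro equalityI subsetI)
    fix x assume "x \<in> proj H ` Sym_rank_le V (CARD('v))"
    then show "x \<in> affine_space ?I" by (auto simp: proj_def H)
  next
    fix x assume x: "x \<in> affine_space ?I"
    define A :: "complex ^ 'v ^ 'v" where "A = (\<chi> i j. if i \<in> V \<and> j \<in> V then
      (if i = j then x (Inl i) else x (Inr {i, j})) else 0)"
    have sym: "transpose A = A"
      by (auto simp: A_def transpose_def vec_eq_iff insert_commute)
    have "rank A \<le> CARD('v)"
      unfolding row_rank_def_gen using vec.dim_subset_UNIV[of "rows A"]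
      by (simp add: vec.dimension_def card_cart_basis)
    then have A: "A \<in> Sym_rank_le V (CARD('v))"
      using sym by (auto simp: Sym_rank_le_def Sym_def A_def)
    have "proj H A c = x c" for c
    proof (cases "c \<in> ?I")
      case False
      then show ?thesis using x by (auto simp: proj_def H PiE_def extensional_def)
    next
      case True
      then show ?thesis
      proof (cases c)
        case (Inl i)
        with True show ?thesis by (auto simp: proj_def H A_def)
      next
        case (Inr e)
        with True have "e \<in> E" by auto
        then have "e \<subseteq> V" "card e = 2"
          using assms by (auto simp: simple_graph_def H)
        then obtain i j where "e = {i, j}" "i \<noteq> j" "i \<in> V" "j \<in> V"
          by (auto simp: card_2_iff)
        then show ?thesis using True Inr edge_entry_doubleton[OF sym]
          by (auto simp: proj_def H A_def)
      qed
    qed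
    then have "proj H A = x" by blast
    with A show "x \<in> proj H ` Sym_rank_le V (CARD('v))" by blast
  qed
  then have "proj_dominant H (CARD('v))"
    by (auto simp: proj_dominant_def zariski_closure_def H)
  then show ?thesis unfolding gcr_def by (rule LeastI)
qed

end

theory Submission
  imports Defs
begin

text \<open>
  Let \<open>K = V\<^sub>1 \<inter> V\<^sub>2\<close> and let \<open>r\<close> be a rank for which both projections are dominant. Since \<open>K\<close>
  is a clique, the whole block \<open>B\<close> of a matrix on \<open>K \<times> K\<close> is visible in the projection, so
  dominance forces \<open>card K \<le> r\<close> and \<open>det B\<close> is not identically zero. By a Schur complement
  argument, the symmetric matrices of rank at most \<open>r\<close> with \<open>det B \<noteq> 0\<close> are among the matrices
  \<open>W B W\<^sup>T + Z Z\<^sup>T\<close>, where \<open>W\<close> has \<open>card K\<close> columns and restricts to the identity on \<open>K\<close>, and \<open>Z\<close>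
  has \<open>r - card K\<close> columns and vanishes on \<open>K\<close>; all matrices of this form have rank at most \<open>r\<close>.
  Hence each projection is still dominant on this polynomial family over the space of blocks \<open>B\<close>.
  Two members with the same \<open>B\<close>, one for each graph, are glued by stacking the rows of their
  \<open>W\<close> and \<open>Z\<close>. A polynomial vanishing on all glued points vanishes identically: fix the
  parameters of the second graph and use density for the first one; then fix the coordinates of the
  first graph outside \<open>K\<close> and use density for the second one. This replaces Chevalley's theorem
  on constructible images.
\<close>

section \<open>Complex symmetric matrices: rank and sums of squares\<close>

lemma transpose_eq_iff: "transpose A = A \<longleftrightarrow> (\<forall>i j. A $ i $ j = A $ j $ i)"
  by (auto simp: transpose_def vec_eq_iff)

lemma subspace_range_matrix: "vec.subspace (range ((*v) (A :: 'a::field ^ 'n ^ 'm)))"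
  using vec.linear_subspace_image[OF matrix_vector_mul_linear_gen vec.subspace_UNIV] .

lemma span_columns_eq_range: "vec.span (columns (A :: 'a::field ^ 'n ^ 'm)) = range ((*v) A)"
proof
  have "column j A = A *v axis j 1" for j
    by (simp add: vec_eq_iff column_def matrix_vector_mult_def axis_def mult_delta_right)
  then have "columns A \<subseteq> range ((*v) A)"
    by (auto simp: columns_def)
  then show "vec.span (columns A) \<subseteq> range ((*v) A)"
    by (rule vec.span_minimal) (rule subspace_range_matrix)
qed (auto intro: matrix_vector_mult_in_columnspace_gen)

text \<open>\<open>rank\<close> is the dimension of the row space, and for a symmetric matrix the
  rows are the columns. Rank bounds thus become dimension bounds on ranges of linear maps.\<close>

lemma rank_symmetric:
  fixes A :: "'a::field ^ 'n ^ 'n"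
  assumes "transpose A = A"
  shows "rank A = vec.dim (range ((*v) A))"
  by (metis assms row_rank_def_gen rows_transpose span_columns_eq_range vec.dim_span)

text \<open>If a diagonal entry is nonzero, a unit vector gives a nonzero value; otherwise the sum
  of two unit vectors gives twice a nonzero off-diagonal entry. A complex square root then rescales
  the value to 1.\<close>

lemma symmetric_nonzero_quadratic_form:
  fixes S :: "complex ^ 'n ^ 'n"
  assumes sym: "\<And>i j. S $ i $ j = S $ j $ i" and "S \<noteq> 0"
  obtains u where "(\<Sum>i\<in>UNIV. u $ i * (S *v u) $ i) = 1"
proof -
  have "\<exists>u. (\<Sum>i\<in>UNIV. u $ i * (S *v u) $ i) \<noteq> 0"
  proof (cases "\<exists>i. S $ i $ i \<noteq> 0")
    case True
    then obtain i where "S $ i $ i \<noteq> 0" by blast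
    then have "(\<Sum>k\<in>UNIV. axis i 1 $ k * (S *v axis i 1) $ k) \<noteq> 0"
      by (simp add: matrix_vector_mult_def axis_def mult_delta_left mult_delta_right)
    then show ?thesis by blast
  next
    case False
    from \<open>S \<noteq> 0\<close> obtain i j where ij: "S $ i $ j \<noteq> 0"
      by (auto simp: vec_eq_iff)
    have "(\<Sum>k\<in>UNIV. (axis i 1 + axis j 1) $ k * (S *v (axis i 1 + axis j 1)) $ k)
        = S $ i $ i + S $ i $ j + (S $ j $ i + S $ j $ j)"
      by (simp add: matrix_vector_mult_def axis_def distrib_left distrib_right sum.distrib
          mult_delta_left mult_delta_right)
    also have "\<dots> = 2 * S $ i $ j"
      using False sym[of i j] by simp
    finally show ?thesis using ij by (metis mult_eq_0_iff zero_neq_numeral)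
  qed
  then obtain u where u: "(\<Sum>i\<in>UNIV. u $ i * (S *v u) $ i) \<noteq> 0" (is "?q \<noteq> 0")
    by blast
  define c where "c = 1 / csqrt ?q"
  have "c * c * ?q = 1"
    using u by (simp add: c_def power2_eq_square[symmetric] power_divide)
  then have "(\<Sum>i\<in>UNIV. (c *s u) $ i * (S *v (c *s u)) $ i) = 1"
    by (simp add: vector_scalar_commute sum_distrib_left mult_ac)
  then show thesis by (rule that)
qed

text \<open>Diagonalisation over the complex numbers: with \<open>z = S *v u\<close> and
  \<open>u\<close> of value 1 under the quadratic form, subtracting the square of \<open>z\<close>
  lowers the rank. Keeping every \<open>Z l\<close> in the range of \<open>S\<close> later transfers
  the zero rows of \<open>S\<close> to the \<open>Z l\<close>.\<close>

lemma symmetric_sum_of_squares: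
  fixes S :: "complex ^ 'n ^ 'n"
  assumes "\<And>i j. S $ i $ j = S $ j $ i" and "vec.dim (range ((*v) S)) \<le> m"
  shows "\<exists>Z. (\<forall>l. Z l \<in> range ((*v) S)) \<and> (\<forall>i j. S $ i $ j = (\<Sum>l<m. Z l $ i * Z l $ j))"
  using assms
proof (induction m arbitrary: S)
  case 0
  then have "vec.dim (range ((*v) S)) = 0"
    by simp
  then have "range ((*v) S) \<subseteq> {0}"
    by (simp only: vec.dim_eq_0)
  then have "S *v v = 0 *v v" for v
    by auto
  then have "S = 0" by (simp add: matrix_eq)
  then show ?case by (intro exI[of _ "\<lambda>_. 0"]) (auto intro!: image_eqI[of _ _ 0])
next
  case (Suc m)
  show ?case
  proof (cases "S = 0")
    case True
    then show ?thesis by (intro exI[of _ "\<lambda>_. 0"]) (auto intro!: image_eqI[of _ _ 0])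
  next
    case False
    obtain u where u: "(\<Sum>i\<in>UNIV. u $ i * (S *v u) $ i) = 1"
      using symmetric_nonzero_quadratic_form Suc.prems(1) False by metis
    define z where "z = S *v u"
    define S' where "S' = (\<chi> i j. S $ i $ j - z $ i * z $ j)"
    have adj: "(\<Sum>i\<in>UNIV. u $ i * (S *v v) $ i) = (\<Sum>i\<in>UNIV. z $ i * v $ i)" for v
      unfolding z_def matrix_vector_mult_def
      by (simp add: sum_distrib_left sum_distrib_right, subst sum.swap)
         (auto intro!: sum.cong simp: Suc.prems(1) mult_ac)
    have S'v: "S' *v v = S *v v - (\<Sum>i\<in>UNIV. z $ i * v $ i) *s z" for v
      by (simp add: vec_eq_iff S'_def matrix_vector_mult_def algebra_simps sum_subtractf
          sum_distrib_left sum_distrib_right mult_ac)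
    have "S' *v v = S *v (v - (\<Sum>i\<in>UNIV. z $ i * v $ i) *s u)" for v
      by (simp add: S'v z_def matrix_vector_mult_diff_distrib vector_scalar_commute)
    then have sub: "range ((*v) S') \<subseteq> range ((*v) S)"
      by auto
    \<comment> \<open>Everything in the range of \<open>S'\<close> pairs to 0 with \<open>u\<close>,
      whereas \<open>z\<close> pairs to 1. Hence \<open>z\<close> lies in the range of
      \<open>S\<close> but not in that of \<open>S'\<close>, and the dimension drops
      strictly.\<close>
    have "(\<Sum>i\<in>UNIV. u $ i * (S' *v v) $ i) = 0" for v
    proof -
      define s where "s = (\<Sum>i\<in>UNIV. z $ i * v $ i)"
      have "S' *v v = S *v v - s *s z"
        by (simp add: S'v s_def)
      then have "(\<Sum>i\<in>UNIV. u $ i * (S' *v v) $ i)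
          = (\<Sum>i\<in>UNIV. u $ i * (S *v v) $ i) - s * (\<Sum>i\<in>UNIV. u $ i * z $ i)"
        by (simp add: right_diff_distrib sum_subtractf sum_distrib_left mult_ac)
      then show ?thesis using u by (simp add: adj z_def s_def)
    qed
    then have "z \<noteq> S' *v v" for v
      using u unfolding z_def by force
    then have "z \<notin> range ((*v) S')" by blast
    with sub have "range ((*v) S') \<subset> range ((*v) S)"
      by (auto simp: z_def)
    then have "vec.dim (range ((*v) S')) < vec.dim (range ((*v) S))"
      by (intro vec.dim_psubset) (simp add: vec.span_eq_iff[THEN iffD2] subspace_range_matrix)
    then have "vec.dim (range ((*v) S')) \<le> m"
      using Suc.prems(2) by simp
    moreover have "S' $ i $ j = S' $ j $ i" for i j
      by (simp add: S'_def Suc.prems(1)[of i j])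
    ultimately obtain Z where Z: "\<And>l. Z l \<in> range ((*v) S')"
      "\<And>i j. S' $ i $ j = (\<Sum>l<m. Z l $ i * Z l $ j)"
      using Suc.IH[of S'] by blast
    have "S $ i $ j = (\<Sum>l<Suc m. (Z(m := z)) l $ i * (Z(m := z)) l $ j)" for i j
      using Z(2)[of i j] by (simp add: S'_def algebra_simps)
    moreover have "(Z(m := z)) l \<in> range ((*v) S)" for l
      using Z(1)[of l] sub by (auto simp: z_def)
    ultimately show ?thesis by blast
  qed
qed

text \<open>\<^const>\<open>proj\<close> without the restriction to the coordinates of a graph: polynomial functions
  ignore the other coordinates anyway.\<close>

definition entries :: "complex ^ 'v ^ 'v \<Rightarrow> 'v::finite + 'v set \<Rightarrow> complex" where
  "entries A c = (case c of Inl i \<Rightarrow> A $ i $ i | Inr e \<Rightarrow> edge_entry A e)"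

definition coord_entry :: "('v + 'v set \<Rightarrow> complex) \<Rightarrow> 'v \<Rightarrow> 'v \<Rightarrow> complex" where
  "coord_entry x i j = (if i = j then x (Inl i) else x (Inr {i, j}))"

lemma coord_entry_commute: "coord_entry x i j = coord_entry x j i"
  by (simp add: coord_entry_def insert_commute)

lemma coord_entry_entries: "transpose A = A \<Longrightarrow> coord_entry (entries A) i j = A $ i $ j"
  by (simp add: coord_entry_def entries_def edge_entry_doubleton)

section \<open>Matrices extending a given block on \<open>K\<close>\<close>

definition extension_params ::
  "'v::finite set \<Rightarrow> 'v set \<Rightarrow> complex ^ 'v ^ 'v \<Rightarrow> (nat \<Rightarrow> complex ^ 'v) \<Rightarrow> bool" where
  "extension_params K V W Z \<longleftrightarrow>
    (\<forall>i\<in>K. \<forall>a\<in>K. W $ i $ a = (if i = a then 1 else 0)) \<and>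
    (\<forall>i. i \<notin> V \<longrightarrow> (\<forall>a\<in>K. W $ i $ a = 0)) \<and>
    (\<forall>l i. i \<in> K \<or> i \<notin> V \<longrightarrow> Z l $ i = 0)"

text \<open>The block is given as a coordinate vector \<open>x\<close>, read through
  \<open>coord_entry\<close>, so that for fixed \<open>W\<close> and \<open>Z\<close> the entries
  are polynomial functions of \<open>x\<close>. This also makes the block symmetric for every
  \<open>x\<close>.\<close>

definition extension_matrix :: "'v::finite set \<Rightarrow> nat \<Rightarrow> ('v + 'v set \<Rightarrow> complex) \<Rightarrow>
    complex ^ 'v ^ 'v \<Rightarrow> (nat \<Rightarrow> complex ^ 'v) \<Rightarrow> complex ^ 'v ^ 'v" where
  "extension_matrix K m x W Z = (\<chi> i j.
    (\<Sum>a\<in>K. \<Sum>b\<in>K. W $ i $ a * coord_entry x a b * W $ j $ b) + (\<Sum>l<m. Z l $ i * Z l $ j))"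

lemma extension_matrix_symmetric:
  "transpose (extension_matrix K m x W Z) = extension_matrix K m x W Z"
proof -
  have "(\<Sum>a\<in>K. \<Sum>b\<in>K. W $ i $ a * coord_entry x a b * W $ j $ b)
      = (\<Sum>a\<in>K. \<Sum>b\<in>K. W $ j $ a * coord_entry x a b * W $ i $ b)" for i j
    by (subst sum.swap) (simp add: mult_ac coord_entry_commute)
  then show ?thesis
    by (simp add: transpose_eq_iff extension_matrix_def mult.commute)
qed

lemma extension_matrix_clique_block:
  assumes "extension_params K V W Z" "i \<in> K" "j \<in> K"
  shows "extension_matrix K m x W Z $ i $ j = coord_entry x i j"
proof -
  have "(\<Sum>a\<in>K. \<Sum>b\<in>K. W $ i $ a * coord_entry x a b * W $ j $ b)
      = (\<Sum>a\<in>K. if i = a then \<Sum>b\<in>K. if j = b then coord_entry x a b else 0 else 0)"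
    using assms by (intro sum.cong) (auto simp: extension_params_def mult_delta_right)
  also have "\<dots> = coord_entry x i j"
    using assms by simp
  finally show ?thesis
    using assms by (simp add: extension_matrix_def extension_params_def)
qed

lemma extension_matrix_cong:
  assumes "\<And>a b. a \<in> K \<Longrightarrow> b \<in> K \<Longrightarrow> coord_entry x a b = coord_entry y a b"
  shows "extension_matrix K m x W Z = extension_matrix K m y W Z"
  using assms by (simp add: extension_matrix_def cong: sum.cong)

text \<open>The range is spanned by the columns of \<open>W\<close> indexed by \<open>K\<close>
  together with the \<open>m\<close> vectors \<open>Z l\<close>.\<close>

lemma extension_matrix_rank_le:
  assumes "extension_params K V W Z"
  shows "extension_matrix K m x W Z \<in> Sym_rank_le V (card K + m)"
proof -
  let ?M = "extension_matrix K m x W Z"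
  let ?B = "(\<lambda>a. column a W) ` K \<union> Z ` {..<m}"
  have "?M *v v \<in> vec.span ?B" for v
  proof -
    have "?M *v v = (\<Sum>a\<in>K. (\<Sum>j\<in>UNIV. \<Sum>b\<in>K. coord_entry x a b * W $ j $ b * v $ j) *s column a W)
        + (\<Sum>l<m. (\<Sum>j\<in>UNIV. Z l $ j * v $ j) *s Z l)"
    proof -
      have "(?M *v v) $ i = (\<Sum>j\<in>UNIV. \<Sum>a\<in>K. \<Sum>b\<in>K. W $ i $ a * coord_entry x a b * W $ j $ b * v $ j)
          + (\<Sum>j\<in>UNIV. \<Sum>l<m. Z l $ i * Z l $ j * v $ j)" for i
        by (simp add: matrix_vector_mult_def extension_matrix_def distrib_right sum_distrib_right
            sum.distrib)
      then show ?thesis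
        by (simp add: vec_eq_iff column_def sum_distrib_left sum_distrib_right mult_ac
            sum.swap[of _ _ UNIV])
    qed
    then show ?thesis
      by (auto intro!: vec.span_add vec.span_sum vec.span_scale intro: vec.span_base)
  qed
  then have "vec.dim (range ((*v) ?M)) \<le> card ?B"
    by (intro vec.dim_le_card) auto
  also have "\<dots> \<le> card K + m"
    by (rule order.trans[OF card_Un_le add_mono])
      (use card_image_le[of "{..<m}" Z] in \<open>auto intro: card_image_le\<close>)
  finally have "rank ?M \<le> card K + m"
    by (simp add: rank_symmetric extension_matrix_symmetric)
  moreover have "?M $ i $ j = 0" if "i \<notin> V \<or> j \<notin> V" for i j
  proof -
    have "?M $ i $ j = (\<Sum>a\<in>K. \<Sum>b\<in>K. 0) + (\<Sum>l<m. 0)"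
      unfolding extension_matrix_def using assms that
      by (auto simp: extension_params_def intro!: sum.neutral)
    then show ?thesis by simp
  qed
  ultimately show ?thesis
    by (simp add: Sym_rank_le_def Sym_def extension_matrix_symmetric)
qed

text \<open>The principal minor on \<open>K\<close>: the block is padded by an identity outside
  \<open>K\<close>, so that it becomes a square matrix over the ambient type without changing the
  determinant.\<close>

definition clique_minor :: "'v::finite set \<Rightarrow> ('v + 'v set \<Rightarrow> complex) \<Rightarrow> complex" where
  "clique_minor K x =
    det (\<chi> i j. if i \<in> K \<and> j \<in> K then coord_entry x i j else if i = j then 1 else 0)"

text \<open>Take \<open>W\<close> to be the columns of \<open>A\<close> over \<open>K\<close> times
  the inverse of the block. The Schur complement left over is zero on the rows in \<open>K\<close>,
  which makes its rank at most \<open>r - card K\<close>, so it is a sum of that many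
  squares.\<close>

lemma extension_matrix_exists:
  assumes A: "A \<in> Sym_rank_le V r" and "K \<subseteq> V" and "clique_minor K (entries A) \<noteq> 0"
  obtains W Z where "card K \<le> r" "extension_params K V W Z"
    "A = extension_matrix K (r - card K) (entries A) W Z"
proof -
  have tA: "transpose A = A" and A0: "\<And>i j. i \<notin> V \<or> j \<notin> V \<Longrightarrow> A $ i $ j = 0" and rA: "rank A \<le> r"
    using A by (auto simp: Sym_rank_le_def Sym_def)
  have sA: "\<And>i j. A $ i $ j = A $ j $ i"
    using tA transpose_eq_iff by blast
  define N where "N = (\<chi> i j. if i \<in> K \<and> j \<in> K then A $ i $ j else if i = j then 1 else 0)"
  have "det N \<noteq> 0"
    using assms(3) by (simp add: clique_minor_def N_def coord_entry_entries[OF tA] cong: if_cong)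
  then obtain C where C: "C ** N = mat 1" "N ** C = mat 1"
    by (metis invertible_def invertible_det_nz)
  define AK where "AK = (\<chi> i j. if j \<in> K then A $ i $ j else 0)"
  define W where "W = AK ** C"
  have "W ** N = AK"
    by (simp add: W_def C matrix_mul_assoc[symmetric])
  have WA: "(\<Sum>a\<in>K. W $ i $ a * A $ a $ b) = A $ i $ b" if "b \<in> K" for i b
  proof -
    have "A $ i $ b = (W ** N) $ i $ b"
      using that \<open>W ** N = AK\<close> by (simp add: AK_def)
    also have "\<dots> = (\<Sum>a\<in>UNIV. if a \<in> K then W $ i $ a * A $ a $ b else 0)"
      unfolding matrix_matrix_mult_def using that by (auto simp: N_def intro!: sum.cong)
    finally show ?thesis by (simp add: sum.If_cases)
  qed
  have W1: "W $ i $ a = (if i = a then 1 else 0)" if "i \<in> K" for i a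
  proof -
    have "W $ i $ a = (N ** C) $ i $ a"
      unfolding W_def matrix_matrix_mult_def using that by (auto simp: N_def AK_def intro!: sum.cong)
    then show ?thesis by (simp add: C mat_def)
  qed
  have W0: "W $ i $ a = 0" if "i \<notin> V" for i a
    using that by (simp add: W_def AK_def matrix_matrix_mult_def A0 cong: if_cong)
  \<comment> \<open>the Schur complement of the \<open>K \<times> K\<close> block\<close>
  define S where "S = (\<chi> i j. A $ i $ j - (\<Sum>b\<in>K. A $ i $ b * W $ j $ b))"
  have WAW: "(\<Sum>a\<in>K. \<Sum>b\<in>K. W $ i $ a * A $ a $ b * W $ j $ b) = (\<Sum>b\<in>K. A $ i $ b * W $ j $ b)"
    for i j
    by (subst sum.swap) (simp add: WA sum_distrib_right[symmetric])
  have "(\<Sum>b\<in>K. A $ i $ b * W $ j $ b) = (\<Sum>b\<in>K. A $ j $ b * W $ i $ b)" for i j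
    unfolding WAW[symmetric] by (subst sum.swap) (simp add: mult_ac sA)
  then have sS: "S $ i $ j = S $ j $ i" for i j
    unfolding S_def by (simp add: sA[of i j])
  have "S $ i $ j = 0" if "j \<in> K" for i j
  proof -
    have "(\<Sum>b\<in>K. A $ i $ b * W $ j $ b) = (\<Sum>b\<in>K. if j = b then A $ i $ b else 0)"
      by (intro sum.cong) (auto simp: W1 that)
    then show ?thesis using that by (simp add: S_def)
  qed
  moreover have "S $ i $ j = 0" if "j \<notin> V" for i j
    using that by (simp add: S_def A0 W0)
  ultimately have S0: "S $ i $ j = 0" if "i \<in> K \<or> i \<notin> V" for i j
    using that sS by metis
  have Sv0: "(S *v v) $ i = 0" if "i \<in> K \<or> i \<notin> V" for v i
    using S0[OF that] by (simp add: matrix_vector_mult_def)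
  \<comment> \<open>Forming the Schur complement only subtracts combinations of columns of
    \<open>A\<close>, so its range stays inside that of \<open>A\<close>.\<close>
  have "S *v v = A *v (v - (\<chi> b. if b \<in> K then \<Sum>j\<in>UNIV. W $ j $ b * v $ j else 0))" for v
  proof -
    have "(\<Sum>j\<in>UNIV. \<Sum>b\<in>K. A $ i $ b * W $ j $ b * v $ j)
        = (\<Sum>b\<in>UNIV. A $ i $ b * (if b \<in> K then \<Sum>j\<in>UNIV. W $ j $ b * v $ j else 0))" for i
      by (subst sum.swap) (simp add: mult_delta_right sum.If_cases sum_distrib_left mult_ac)
    then show ?thesis
      by (simp add: vec_eq_iff matrix_vector_mult_def S_def left_diff_distrib right_diff_distrib
          sum_subtractf sum_distrib_right)
  qed
  then have SA: "range ((*v) S) \<subseteq> range ((*v) A)"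
    by auto
  \<comment> \<open>On vectors supported in \<open>K\<close>, the rows of \<open>A\<close> in
    \<open>K\<close> already act injectively. Thus \<open>A\<close> maps \<open>T\<close> to a space
    of dimension \<open>card K\<close> that meets the range of \<open>S\<close>, where all
    \<open>K\<close> coordinates vanish, only in 0; the two dimensions add up inside the range of
    \<open>A\<close>.\<close>
  define T :: "(complex ^ 'a) set" where "T = {v. \<forall>i. i \<notin> K \<longrightarrow> v $ i = 0}"
  have T: "vec.subspace T"
    by (auto simp: T_def vec.subspace_def)
  have inj: "v = 0" if "v \<in> T" "\<And>i. i \<in> K \<Longrightarrow> (A *v v) $ i = 0" for v
  proof -
    have "(N *v v) $ i = 0" for i
    proof (cases "i \<in> K")
      case True
      then have "(N *v v) $ i = (A *v v) $ i"
        using that(1) unfolding matrix_vector_mult_def by (auto simp: N_def T_def intro!: sum.cong)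
      then show ?thesis using that(2) True by simp
    next
      case False
      then show ?thesis
        using that(1) by (simp add: matrix_vector_mult_def N_def T_def mult_delta_left)
    qed
    then have "N *v v = 0" by (simp add: vec_eq_iff)
    then have "(C ** N) *v v = 0" by (simp add: matrix_vector_mul_assoc[symmetric])
    then show ?thesis by (simp add: C)
  qed
  have "inj_on ((*v) A) (vec.span T)"
  proof (rule inj_onI)
    fix u v assume "u \<in> vec.span T" "v \<in> vec.span T" and eq: "A *v u = A *v v"
    then have "u - v \<in> T"
      using T by (simp add: vec.span_eq_iff[THEN iffD2] vec.subspace_diff)
    with inj[of "u - v"] eq show "u = v"
      by (simp add: matrix_vector_mult_diff_distrib)
  qed
  then have dT: "vec.dim ((*v) A ` T) = card K"
    using vec.dim_image_eq[OF matrix_vector_mul_linear_gen, of A T]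
    by (simp add: T_def dim_substandard_cart)
  have "(*v) A ` T \<inter> range ((*v) S) \<subseteq> {0}"
  proof safe
    fix v w assume "v \<in> T" "A *v v = S *v w"
    then have "v = 0" using inj Sv0 by metis
    then show "A *v v = 0" by simp
  qed
  then have "vec.dim ((*v) A ` T \<inter> range ((*v) S)) = 0"
    by (simp add: vec.dim_eq_0)
  then have "card K + vec.dim (range ((*v) S))
      = vec.dim {x + y |x y. x \<in> (*v) A ` T \<and> y \<in> range ((*v) S)}"
    using vec.dim_sums_Int[of "(*v) A ` T" "range ((*v) S)"] dT T
    by (simp add: subspace_range_matrix vec.linear_subspace_image[OF matrix_vector_mul_linear_gen]
        del: vec.dim_eq_0)
  also have "\<dots> \<le> vec.dim (range ((*v) A))"
    using SA subspace_range_matrix[of A] by (intro vec.dim_subset) (auto intro!: vec.subspace_add)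
  also have "\<dots> \<le> r"
    using rA rank_symmetric[OF tA] by simp
  finally have r: "card K + vec.dim (range ((*v) S)) \<le> r" .
  obtain Z where Z: "\<And>l. Z l \<in> range ((*v) S)"
    "\<And>i j. S $ i $ j = (\<Sum>l<r - card K. Z l $ i * Z l $ j)"
    using symmetric_sum_of_squares[OF sS, of "r - card K"] r by force
  have "Z l $ i = 0" if "i \<in> K \<or> i \<notin> V" for l i
    using Z(1)[of l] Sv0[OF that] by auto
  then have "extension_params K V W Z"
    by (auto simp: extension_params_def W0 W1)
  moreover have "A = extension_matrix K (r - card K) (entries A) W Z"
    by (simp add: vec_eq_iff extension_matrix_def coord_entry_entries[OF tA] WAW Z(2)[symmetric] S_def)
  ultimately show thesis using that r by simp
qed

section \<open>Polynomial functions and Zariski density\<close>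

lemma poly_fun_cong:
  assumes "poly_fun I f" "\<And>i. i \<in> I \<Longrightarrow> x i = y i"
  shows "f x = f y"
  using assms by (induction rule: poly_fun.induct) auto

lemma poly_fun_mono: "poly_fun I f \<Longrightarrow> I \<subseteq> J \<Longrightarrow> poly_fun J f"
  by (induction rule: poly_fun.induct) (auto intro: poly_fun.intros)

lemma poly_fun_subst:
  assumes "poly_fun I f" "\<And>i. i \<in> I \<Longrightarrow> poly_fun J (\<lambda>y. s y i)"
  shows "poly_fun J (\<lambda>y. f (s y))"
  using assms by (induction rule: poly_fun.induct) (auto intro: poly_fun.intros)

lemma poly_fun_sum: "(\<And>a. a \<in> A \<Longrightarrow> poly_fun I (f a)) \<Longrightarrow> poly_fun I (\<lambda>x. \<Sum>a\<in>A. f a x)"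
  by (induction A rule: infinite_finite_induct) (auto intro: poly_fun.intros)

lemma poly_fun_prod: "(\<And>a. a \<in> A \<Longrightarrow> poly_fun I (f a)) \<Longrightarrow> poly_fun I (\<lambda>x. \<Prod>a\<in>A. f a x)"
  by (induction A rule: infinite_finite_induct) (auto intro: poly_fun.intros)

lemma poly_fun_on_line:
  assumes "poly_fun I f"
  shows "\<exists>p. \<forall>t. f (\<lambda>i. x i + t * (y i - x i)) = poly p t"
  using assms
proof (induction rule: poly_fun.induct)
  case (const c)
  show ?case by (intro exI[of _ "[:c:]"]) simp
next
  case (coord i)
  show ?case by (intro exI[of _ "[:x i, y i - x i:]"]) simp
next
  case (add f g)
  then show ?case by (metis poly_add)
next
  case (mult f g)
  then show ?case by (metis poly_mult)
qed

text \<open>Polynomial functions have no zero divisors: restricting both factors to the line from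
  \<open>x\<close> (at parameter 0) to \<open>y\<close> (at parameter 1) reduces this to univariate
  polynomials.\<close>

lemma poly_fun_mult_eq_0:
  assumes f: "poly_fun I f" and g: "poly_fun I g"
    and fg: "\<And>x. f x * g x = 0" and x: "f x \<noteq> 0"
  shows "g y = 0"
proof -
  obtain p q where p: "\<And>t. f (\<lambda>i. x i + t * (y i - x i)) = poly p t"
    and q: "\<And>t. g (\<lambda>i. x i + t * (y i - x i)) = poly q t"
    using poly_fun_on_line[OF f] poly_fun_on_line[OF g] by metis
  have "poly (p * q) t = 0" for t
    using fg by (simp flip: p q)
  then have "p * q = 0"
    using poly_all_0_iff_0 by blast
  moreover have "p \<noteq> 0"
    using p[of 0] x by auto
  ultimately have "q = 0" by simp
  then show ?thesis using q[of 1] by simp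
qed

text \<open>Points are arbitrary functions instead of extensional ones. Since polynomial functions
  read only the coordinates in \<open>I\<close>, this spares the restrictions when coordinates are
  substituted or glued.\<close>

definition zariski_dense :: "'i set \<Rightarrow> ('i \<Rightarrow> complex) set \<Rightarrow> bool" where
  "zariski_dense I S \<longleftrightarrow> (\<forall>f. poly_fun I f \<longrightarrow> (\<forall>y\<in>S. f y = 0) \<longrightarrow> (\<forall>x. f x = 0))"

lemma zariski_denseD:
  "zariski_dense I S \<Longrightarrow> poly_fun I f \<Longrightarrow> (\<And>y. y \<in> S \<Longrightarrow> f y = 0) \<Longrightarrow> f x = 0"
  by (auto simp: zariski_dense_def)

lemma proj_dominant_iff:
  "proj_dominant (V, E) r \<longleftrightarrow> zariski_dense (V <+> E) (entries ` Sym_rank_le V r)"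
proof -
  let ?I = "V <+> E"
  have proj: "f (proj (V, E) A) = f (entries A)" if "poly_fun ?I f" for f A
    by (rule poly_fun_cong[OF that]) (simp add: proj_def entries_def)
  have ext: "f (restrict x ?I) = f x" if "poly_fun ?I f" for f x
    by (rule poly_fun_cong[OF that]) simp
  have "proj_dominant (V, E) r \<longleftrightarrow> (\<forall>f. poly_fun ?I f \<longrightarrow> (\<forall>A\<in>Sym_rank_le V r. f (entries A) = 0) \<longrightarrow>
      (\<forall>x\<in>affine_space ?I. f x = 0))"
    by (auto simp: proj_dominant_def zariski_closure_def set_eq_iff proj)
  also have "\<dots> \<longleftrightarrow> zariski_dense ?I (entries ` Sym_rank_le V r)"
  proof -
    have "(\<forall>x\<in>affine_space ?I. f x = 0) \<longleftrightarrow> (\<forall>x. f x = 0)" if "poly_fun ?I f" for f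
    proof -
      have "restrict x ?I \<in> affine_space ?I" for x :: "'a + 'a set \<Rightarrow> complex"
        by auto
      then show ?thesis using ext[OF that] by metis
    qed
    then show ?thesis by (auto simp: zariski_dense_def)
  qed
  finally show ?thesis .
qed

lemma proj_dominant_mono: "proj_dominant (V, E) r \<Longrightarrow> r \<le> s \<Longrightarrow> proj_dominant (V, E) s"
  by (auto simp: proj_dominant_iff zariski_dense_def Sym_rank_le_def)

lemma entries_cong:
  assumes "c \<in> V <+> E" "simple_graph (V, E)" "transpose A = A" "transpose B = B"
    "\<And>i j. i \<in> V \<Longrightarrow> j \<in> V \<Longrightarrow> A $ i $ j = B $ i $ j"
  shows "entries A c = entries B c"
proof (cases c)
  case (Inl i)
  then show ?thesis using assms by (auto simp: entries_def)
next
  case (Inr e)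
  with assms have "e \<subseteq> V" "card e = 2"
    by (auto simp: simple_graph_def)
  then obtain i j where "e = {i, j}" "i \<in> V" "j \<in> V"
    by (auto simp: card_2_iff)
  then show ?thesis
    using assms Inr by (simp add: entries_def edge_entry_doubleton)
qed

text \<open>Zeroing the rows and columns outside \<open>V'\<close> does not raise the rank and
  leaves all coordinates of the subgraph unchanged. A polynomial that vanishes for the subgraph
  therefore vanishes for the large graph as well.\<close>

lemma proj_dominant_subgraph:
  fixes V :: "'v::finite set"
  assumes dom: "proj_dominant (V, E) r" and sub: "V' \<subseteq> V" "E' \<subseteq> E" and G': "simple_graph (V', E')"
  shows "proj_dominant (V', E') r"
  unfolding proj_dominant_iff zariski_dense_def
proof (intro allI impI)
  fix f x
  assume f: "poly_fun (V' <+> E') f" and 0: "\<forall>y\<in>entries ` Sym_rank_le V' r. f y = 0"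
  have "f (entries A) = 0" if A: "A \<in> Sym_rank_le V r" for A
  proof -
    have tA: "transpose A = A" and rA: "rank A \<le> r"
      using A by (auto simp: Sym_rank_le_def Sym_def)
    define P :: "complex ^ 'v ^ 'v" where "P = (\<chi> i j. if i = j then if i \<in> V' then 1 else 0 else 0)"
    define B where "B = P ** A ** P"
    have P: "P ** X = (\<chi> i j. if i \<in> V' then X $ i $ j else 0)"
      "X ** P = (\<chi> i j. if j \<in> V' then X $ i $ j else 0)" for X
      by (simp_all add: vec_eq_iff P_def matrix_matrix_mult_def mult_delta_left mult_delta_right)
    have B: "B $ i $ j = (if i \<in> V' \<and> j \<in> V' then A $ i $ j else 0)" for i j
      by (simp add: B_def P)
    have tB: "transpose B = B"
      using tA by (auto simp: transpose_eq_iff B)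
    have "range ((*v) B) \<subseteq> (*v) P ` range ((*v) A)"
      by (auto simp: B_def simp flip: matrix_vector_mul_assoc)
    then have "vec.dim (range ((*v) B)) \<le> vec.dim ((*v) P ` range ((*v) A))"
      by (rule vec.dim_subset)
    also have "\<dots> \<le> vec.dim (range ((*v) A))"
      by (rule vec.dim_image_le) (rule matrix_vector_mul_linear_gen)
    finally have "B \<in> Sym_rank_le V' r"
      using rA tA tB by (auto simp: Sym_rank_le_def Sym_def rank_symmetric B)
    then have "f (entries B) = 0"
      using 0 by blast
    moreover have "f (entries A) = f (entries B)"
      by (rule poly_fun_cong[OF f], rule entries_cong[OF _ G' tA tB]) (auto simp: B)
    ultimately show ?thesis by simp
  qed
  moreover have "V' <+> E' \<subseteq> V <+> E" using sub by auto
  ultimately show "f x = 0"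
    using zariski_denseD[OF dom[unfolded proj_dominant_iff] poly_fun_mono[OF f]] by blast
qed

section \<open>Dominance on the family of extension matrices\<close>

lemma clique_coords:
  assumes "clique (induced_subgraph (V, E) K)" "K \<subseteq> V" "i \<in> K" "j \<in> K"
  shows "(if i = j then Inl i else Inr {i, j}) \<in> V <+> E"
proof (cases "i = j")
  case False
  then have "{i, j} \<in> {e. e \<subseteq> K \<and> card e = 2}" using assms by auto
  also have "\<dots> \<subseteq> E" using assms(1) by (auto simp: clique_def induced_subgraph_def)
  finally show ?thesis using False by auto
qed (use assms in auto)

lemma coord_entry_eq: "coord_entry x i j = x (if i = j then Inl i else Inr {i, j})"
  by (simp add: coord_entry_def)

lemma poly_fun_clique_minor:
  assumes "\<And>i j. i \<in> K \<Longrightarrow> j \<in> K \<Longrightarrow> poly_fun I (\<lambda>x. coord_entry x i j)"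
  shows "poly_fun I (clique_minor K)"
proof -
  have "poly_fun I (\<lambda>x. if i \<in> K \<and> j \<in> K then coord_entry x i j else if i = j then 1 else 0)" for i j
    using assms by (cases "i \<in> K \<and> j \<in> K") (auto intro: poly_fun.const)
  then have "poly_fun I (\<lambda>x. clique_minor K x)"
    unfolding clique_minor_def det_def
    by (simp split del: if_split)
      (intro poly_fun_sum poly_fun.mult poly_fun.const poly_fun_prod)
  then show ?thesis .
qed

lemma poly_fun_extension_matrix:
  assumes "\<And>i j. i \<in> K \<Longrightarrow> j \<in> K \<Longrightarrow> poly_fun I (\<lambda>x. coord_entry x i j)"
  shows "poly_fun I (\<lambda>x. extension_matrix K m x W Z $ i $ j)"
  unfolding extension_matrix_def
  by (simp) (intro poly_fun_sum poly_fun.add poly_fun.mult poly_fun.const assms)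

lemma poly_fun_entries_extension_matrix:
  assumes K: "\<And>i j. i \<in> K \<Longrightarrow> j \<in> K \<Longrightarrow> poly_fun I (\<lambda>x. coord_entry x i j)"
    and c: "c \<in> V <+> E" and G: "simple_graph (V, E)"
  shows "poly_fun I (\<lambda>x. entries (extension_matrix K m x W Z) c)"
proof -
  \<comment> \<open>\<open>edge_entry\<close> is a definite description; choosing \<open>i\<close>
    and \<open>j\<close> independently of \<open>x\<close> turns it into a fixed matrix entry, whose
    polynomial dependence on \<open>x\<close> is known.\<close>
  have "\<exists>i j. \<forall>x. entries (extension_matrix K m x W Z) c = extension_matrix K m x W Z $ i $ j"
  proof (cases c)
    case (Inl i)
    then show ?thesis by (auto simp: entries_def)
  next
    case (Inr e)
    with c G have "card e = 2" by (auto simp: simple_graph_def)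
    then obtain i j where "e = {i, j}" by (auto simp: card_2_iff)
    with Inr show ?thesis
      by (auto simp: entries_def edge_entry_doubleton extension_matrix_symmetric)
  qed
  then obtain i j where "\<And>x. entries (extension_matrix K m x W Z) c = extension_matrix K m x W Z $ i $ j"
    by blast
  then show ?thesis using poly_fun_extension_matrix[OF K] by simp
qed

text \<open>Matrices with vanishing minor are absorbed by multiplying the test polynomial by the
  minor: the product vanishes on all matrices of rank at most \<open>r\<close>, hence identically,
  and the minor can be cancelled.\<close>

lemma proj_dominant_extension_matrix:
  assumes dom: "proj_dominant (V, E) r" and K: "K \<subseteq> V" "clique (induced_subgraph (V, E) K)"
  shows "card K \<le> r"
    and "zariski_dense (V <+> E)
      {entries (extension_matrix K (r - card K) x W Z) |x W Z. extension_params K V W Z}"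
proof -
  let ?I = "V <+> E"
  note dense = dom[unfolded proj_dominant_iff]
  have co: "poly_fun ?I (\<lambda>x. coord_entry x i j)" if "i \<in> K" "j \<in> K" for i j
    unfolding coord_entry_eq by (rule poly_fun.coord) (rule clique_coords[OF K(2,1) that])
  note minor = poly_fun_clique_minor[OF co]
  \<comment> \<open>The identity matrix serves only as a point of coordinate space where the minor
    is nonzero; no rank bound is claimed for it.\<close>
  have one: "clique_minor K (entries (mat 1)) \<noteq> 0"
  proof -
    have "(\<chi> i j. if i \<in> K \<and> j \<in> K then coord_entry (entries (mat 1)) i j else if i = j then 1 else 0)
        = (mat 1 :: complex ^ 'a ^ 'a)"
      by (simp add: vec_eq_iff coord_entry_entries[OF transpose_mat]) (simp add: mat_def)
    then show ?thesis by (simp add: clique_minor_def)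
  qed
  show "card K \<le> r"
  proof (rule ccontr)
    assume "\<not> card K \<le> r"
    then have "clique_minor K (entries A) = 0" if "A \<in> Sym_rank_le V r" for A
      using extension_matrix_exists[OF that K(1)] by blast
    then have "clique_minor K (entries (mat 1)) = 0"
      using zariski_denseD[OF dense minor] by blast
    with one show False by simp
  qed
  show "zariski_dense ?I
      {entries (extension_matrix K (r - card K) x W Z) |x W Z. extension_params K V W Z}"
    unfolding zariski_dense_def
  proof (intro allI impI)
    fix f x
    assume f: "poly_fun ?I f" and 0: "\<forall>y\<in>{entries (extension_matrix K (r - card K) x W Z) |x W Z.
      extension_params K V W Z}. f y = 0"
    have "clique_minor K (entries A) * f (entries A) = 0" if A: "A \<in> Sym_rank_le V r" for A
    proof (cases "clique_minor K (entries A) = 0")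
      case False
      then obtain W Z where "extension_params K V W Z"
        "A = extension_matrix K (r - card K) (entries A) W Z"
        using extension_matrix_exists[OF A K(1)] by metis
      then have "entries A \<in> {entries (extension_matrix K (r - card K) x W Z) |x W Z.
          extension_params K V W Z}"
        by (intro CollectI exI[of _ "entries A"] exI[of _ W] exI[of _ Z]) simp
      then have "f (entries A) = 0" using 0 by blast
      then show ?thesis by simp
    qed simp
    then have "clique_minor K y * f y = 0" for y
      using zariski_denseD[OF dense poly_fun.mult[OF minor f]] by blast
    then show "f x = 0"
      using poly_fun_mult_eq_0[OF minor f _ one] by blast
  qed
qed

section \<open>Gluing along the clique\<close>

text \<open>Stacking rows keeps \<open>card K\<close> columns in \<open>W\<close> and
  \<open>r - card K\<close> vectors in \<open>Z\<close>, so the glued matrix again has rank at most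
  \<open>r\<close>.\<close>

lemma proj_dominant_clique_sum:
  fixes V\<^sub>1 V\<^sub>2 :: "'v::finite set"
  assumes G1: "simple_graph (V\<^sub>1, E\<^sub>1)" and G2: "simple_graph (V\<^sub>2, E\<^sub>2)"
    and K1: "clique (induced_subgraph (V\<^sub>1, E\<^sub>1) (V\<^sub>1 \<inter> V\<^sub>2))"
    and K2: "clique (induced_subgraph (V\<^sub>2, E\<^sub>2) (V\<^sub>1 \<inter> V\<^sub>2))"
    and D1: "proj_dominant (V\<^sub>1, E\<^sub>1) r" and D2: "proj_dominant (V\<^sub>2, E\<^sub>2) r"
  shows "proj_dominant (V\<^sub>1 \<union> V\<^sub>2, E\<^sub>1 \<union> E\<^sub>2) r"
  unfolding proj_dominant_iff zariski_dense_def
proof (intro allI impI)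
  define K where "K = V\<^sub>1 \<inter> V\<^sub>2"
  define I1 where "I1 = V\<^sub>1 <+> E\<^sub>1"
  define I2 where "I2 = V\<^sub>2 <+> E\<^sub>2"
  let ?M = "extension_matrix K (r - card K)"
  fix f and x :: "'v + 'v set \<Rightarrow> complex"
  assume "poly_fun ((V\<^sub>1 \<union> V\<^sub>2) <+> (E\<^sub>1 \<union> E\<^sub>2)) f"
    and 0: "\<forall>y\<in>entries ` Sym_rank_le (V\<^sub>1 \<union> V\<^sub>2) r. f y = 0"
  moreover have "(V\<^sub>1 \<union> V\<^sub>2) <+> (E\<^sub>1 \<union> E\<^sub>2) = I1 \<union> I2"
    by (auto simp: I1_def I2_def)
  ultimately have f: "poly_fun (I1 \<union> I2) f" by simp
  have KV: "K \<subseteq> V\<^sub>1" "K \<subseteq> V\<^sub>2" by (auto simp: K_def)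
  have Kr: "card K \<le> r"
    using proj_dominant_extension_matrix(1)[OF D1 KV(1)] K1 by (simp add: K_def)
  have dense1: "zariski_dense I1 {entries (?M x W Z) |x W Z. extension_params K V\<^sub>1 W Z}"
    using proj_dominant_extension_matrix(2)[OF D1 KV(1)] K1 by (simp add: K_def I1_def)
  have dense2: "zariski_dense I2 {entries (?M x W Z) |x W Z. extension_params K V\<^sub>2 W Z}"
    using proj_dominant_extension_matrix(2)[OF D2 KV(2)] K2 by (simp add: K_def I2_def)
  have coords: "(if i = j then Inl i else Inr {i, j}) \<in> I1 \<inter> I2" if "i \<in> K" "j \<in> K" for i j
    using clique_coords[OF K1[folded K_def] KV(1) that] clique_coords[OF K2[folded K_def] KV(2) that]
    by (simp add: I1_def I2_def)
  have co: "poly_fun I1 (\<lambda>x. coord_entry x i j)" if "i \<in> K" "j \<in> K" for i j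
    unfolding coord_entry_eq using coords[OF that] by (intro poly_fun.coord) blast
  have M_block: "coord_entry (entries (?M x W Z)) i j = coord_entry x i j"
    if "extension_params K V W Z" "i \<in> K" "j \<in> K" for x W Z V i j
    using that by (simp add: coord_entry_entries extension_matrix_symmetric extension_matrix_clique_block)

  \<comment> \<open>The first graph keeps the coordinates of \<open>y\<close>; those belonging only
    to the second graph are computed from the block of \<open>y\<close> and the given
    parameters.\<close>
  define glue where "glue y W Z = (\<lambda>c. if c \<in> I2 - I1 then entries (?M y W Z) c else y c)" for y W Z
  have glue0: "f (glue y W2 Z2) = 0" if p2: "extension_params K V\<^sub>2 W2 Z2" for y W2 Z2
  proof (rule zariski_denseD[OF dense1, where f = "\<lambda>y. f (glue y W2 Z2)"])
    show "poly_fun I1 (\<lambda>y. f (glue y W2 Z2))"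
    proof (rule poly_fun_subst[OF f])
      fix c assume "c \<in> I1 \<union> I2"
      then show "poly_fun I1 (\<lambda>y. glue y W2 Z2 c)"
        using poly_fun_entries_extension_matrix[OF co _ G2]
        by (cases "c \<in> I1") (auto simp: glue_def I2_def intro: poly_fun.coord)
    qed
  next
    fix y assume "y \<in> {entries (?M x W Z) |x W Z. extension_params K V\<^sub>1 W Z}"
    then obtain x W1 Z1 where y: "y = entries (?M x W1 Z1)" and p1: "extension_params K V\<^sub>1 W1 Z1"
      by blast
    \<comment> \<open>On \<open>K\<close> the two families of rows agree (identity for
      \<open>W\<close>, zero for \<open>Z\<close>), so the stacked parameters restrict to the given
      ones on either vertex set.\<close>
    define W where "W = (\<chi> i. if i \<in> V\<^sub>1 then W1 $ i else W2 $ i)"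
    define Z where "Z l = (\<chi> i. if i \<in> V\<^sub>1 then Z1 l $ i else Z2 l $ i)" for l
    have p: "extension_params K (V\<^sub>1 \<union> V\<^sub>2) W Z"
      using p1 p2 KV by (auto simp: extension_params_def W_def Z_def)
    have W2: "W $ i $ a = W2 $ i $ a" if "i \<in> V\<^sub>2" "a \<in> K" for i a
      using p1 p2 that by (auto simp: extension_params_def W_def K_def)
    have Z2: "Z l $ i = Z2 l $ i" if "i \<in> V\<^sub>2" for l i
      using p1 p2 that by (auto simp: extension_params_def Z_def K_def)
    have y2: "?M y W2 Z2 = ?M x W2 Z2"
      by (rule extension_matrix_cong) (simp add: y M_block[OF p1])
    have "entries (?M x W Z) c = glue y W2 Z2 c" if "c \<in> I1 \<union> I2" for c
    proof (cases "c \<in> I1")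
      case True
      then have "entries (?M x W Z) c = entries (?M x W1 Z1) c"
        unfolding I1_def by (rule entries_cong[OF _ G1]) (simp_all add: extension_matrix_symmetric,
          simp add: extension_matrix_def W_def Z_def)
      then show ?thesis using True by (simp add: glue_def y)
    next
      case False
      with that have c: "c \<in> V\<^sub>2 <+> E\<^sub>2" by (simp add: I2_def)
      then have "entries (?M x W Z) c = entries (?M x W2 Z2) c"
        by (rule entries_cong[OF _ G2]) (simp_all add: extension_matrix_symmetric,
          simp add: extension_matrix_def W2 Z2 cong: sum.cong)
      then show ?thesis using False that by (simp add: glue_def y2)
    qed
    then have "f (entries (?M x W Z)) = f (glue y W2 Z2)"
      by (rule poly_fun_cong[OF f])
    moreover have "?M x W Z \<in> Sym_rank_le (V\<^sub>1 \<union> V\<^sub>2) r"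
      using extension_matrix_rank_le[OF p, of "r - card K" x] Kr by simp
    ultimately show "f (glue y W2 Z2) = 0"
      using 0 by (metis imageI)
  qed

  \<comment> \<open>Now the coordinates of \<open>x\<close> outside the second graph are frozen and
    those of the second graph vary; \<open>merge x = x\<close> recovers the arbitrary point.\<close>
  define merge where "merge y = (\<lambda>c. if c \<in> I2 then y c else x c)" for y
  have "f (merge x) = 0"
  proof (rule zariski_denseD[OF dense2, where f = "\<lambda>y. f (merge y)"])
    show "poly_fun I2 (\<lambda>y. f (merge y))"
    proof (rule poly_fun_subst[OF f])
      show "poly_fun I2 (\<lambda>y. merge y c)" for c
        by (cases "c \<in> I2") (auto simp: merge_def intro: poly_fun.intros)
    qed
  next
    fix y assume "y \<in> {entries (?M x W Z) |x W Z. extension_params K V\<^sub>2 W Z}"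
    then obtain x' W2 Z2 where y: "y = entries (?M x' W2 Z2)" and p2: "extension_params K V\<^sub>2 W2 Z2"
      by blast
    have "coord_entry (merge y) i j = coord_entry x' i j" if "i \<in> K" "j \<in> K" for i j
    proof -
      have "coord_entry (merge y) i j = coord_entry y i j"
        using coords[OF that] by (auto simp: coord_entry_eq merge_def)
      then show ?thesis using M_block[OF p2 that] by (simp add: y)
    qed
    then have "?M (merge y) W2 Z2 = ?M x' W2 Z2"
      by (rule extension_matrix_cong)
    \<comment> \<open>Since \<open>merge y\<close> has the same block as \<open>y\<close>, gluing
      recomputes exactly the coordinates of \<open>y\<close> that it already contains.\<close>
    then have "glue (merge y) W2 Z2 = merge y"
      by (auto simp: glue_def merge_def y)
    then show "f (merge y) = 0"
      using glue0[OF p2, of "merge y"] by simp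
  qed
  moreover have "merge x = x" by (auto simp: merge_def)
  ultimately show "f x = 0" by simp
qed

theorem theorem1p12:
  fixes V\<^sub>1 V\<^sub>2 :: "'v::finite set" and E\<^sub>1 E\<^sub>2 :: "'v set set"
  assumes "simple_graph (V\<^sub>1, E\<^sub>1)" and "simple_graph (V\<^sub>2, E\<^sub>2)"
    and "clique (induced_subgraph (V\<^sub>1, E\<^sub>1) (V\<^sub>1 \<inter> V\<^sub>2))"
    and "clique (induced_subgraph (V\<^sub>2, E\<^sub>2) (V\<^sub>1 \<inter> V\<^sub>2))"
  shows "gcr (clique_sum (V\<^sub>1, E\<^sub>1) (V\<^sub>2, E\<^sub>2)) = max (gcr (V\<^sub>1, E\<^sub>1)) (gcr (V\<^sub>2, E\<^sub>2))"
proof (rule antisym)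
  let ?G = "(V\<^sub>1 \<union> V\<^sub>2, E\<^sub>1 \<union> E\<^sub>2)"
  have G: "clique_sum (V\<^sub>1, E\<^sub>1) (V\<^sub>2, E\<^sub>2) = ?G"
    by (simp add: clique_sum_def)
  have "simple_graph ?G"
    using assms(1,2) by (auto simp: simple_graph_def)
  then have D: "proj_dominant ?G (gcr ?G)"
    by (rule proj_dominant_gcr)
  have "proj_dominant (V\<^sub>1, E\<^sub>1) (gcr ?G)" "proj_dominant (V\<^sub>2, E\<^sub>2) (gcr ?G)"
    using assms(1,2) by (auto intro: proj_dominant_subgraph[OF D])
  then have "gcr (V\<^sub>1, E\<^sub>1) \<le> gcr ?G" "gcr (V\<^sub>2, E\<^sub>2) \<le> gcr ?G"
    unfolding gcr_def[of "(V\<^sub>1, E\<^sub>1)"] gcr_def[of "(V\<^sub>2, E\<^sub>2)"] by (auto intro: Least_le)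
  then show "max (gcr (V\<^sub>1, E\<^sub>1)) (gcr (V\<^sub>2, E\<^sub>2)) \<le> gcr (clique_sum (V\<^sub>1, E\<^sub>1) (V\<^sub>2, E\<^sub>2))"
    by (simp add: G)
  let ?r = "max (gcr (V\<^sub>1, E\<^sub>1)) (gcr (V\<^sub>2, E\<^sub>2))"
  \<comment> \<open>Gluing needs one common rank, so both dominance statements are first raised to
    the maximum.\<close>
  have "proj_dominant (V\<^sub>1, E\<^sub>1) ?r" "proj_dominant (V\<^sub>2, E\<^sub>2) ?r"
    using proj_dominant_mono proj_dominant_gcr assms(1,2) by (metis max.cobounded1 max.cobounded2)+
  then have "proj_dominant ?G ?r"
    by (rule proj_dominant_clique_sum[OF assms])
  then show "gcr (clique_sum (V\<^sub>1, E\<^sub>1) (V\<^sub>2, E\<^sub>2)) \<le> ?r"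
    unfolding G gcr_def[of ?G] by (rule Least_le)
qed

end
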